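(* Let $k\geq 1$ and $n\geq 2(k+1)^2$ be integers, and let $G$ be a simple graph of order $n$ with minimum degree $\delta(G)\geq k$. If $$\mu(G)\geq\frac{n^2}{n-1}-\frac{nk}{n-1}-\frac{2}{\sqrt{n-1}},$$ then $G$ is traceable from every vertex, unless $G=K_1\vee(K_{n-k-1}+K_k)$.
   Context: All graphs are finite and simple; equality of graphs is up to isomorphism. $\mu(G)$ is the spectral radius of $G$, i.e. the largest eigenvalue of its adjacency matrix. $G_1+G_2$ denotes the disjoint union of graphs $G_1,G_2$, and $G_1\vee G_2$ denotes their join (the disjoint union together with all edges between $V(G_1)$ and $V(G_2)$). $K_m$ is the complete graph on $m$ vertices. A graph is traceable from a vertex $x$ if it has a Hamiltonian path starting at $x$; it is traceable from every vertex if this holds for every vertex $x$. *)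

theory Defs
  imports
    "Graph_Theory.Pair_Digraph"
    "Graph_Theory.Digraph_Isomorphism"
    "Graph_Theory.Vertex_Walk"
    "Jordan_Normal_Form.Spectral_Radius"
begin

text \<open>
  A finite simple graph is a \<open>pair_graph\<close>: a finite vertex set with a symmetric irreflexive arc
  relation, each undirected edge \<open>uv\<close> being the two arcs \<open>(u, v)\<close> and \<open>(v, u)\<close>. The operations
  below work on these; invariants are defined for arbitrary digraphs of the library, and \<open>with_proj\<close>
  coerces implicitly. Equality of graphs up to isomorphism is \<open>digraph_iso\<close>.
\<close>

definition complete_graph :: "nat \<Rightarrow> nat pair_pre_digraph" where
  "complete_graph m =
     \<lparr> pverts = {..<m}, parcs = {(u, v). u < m \<and> v < m \<and> u \<noteq> v} \<rparr>"

definition disjoint_union ::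
    "'a pair_pre_digraph \<Rightarrow> 'b pair_pre_digraph \<Rightarrow> ('a + 'b) pair_pre_digraph" where
  "disjoint_union G H =
     \<lparr> pverts = pverts G <+> pverts H,
       parcs = map_prod Inl Inl ` parcs G \<union> map_prod Inr Inr ` parcs H \<rparr>"

definition join ::
    "'a pair_pre_digraph \<Rightarrow> 'b pair_pre_digraph \<Rightarrow> ('a + 'b) pair_pre_digraph" where
  "join G H =
     \<lparr> pverts = pverts G <+> pverts H,
       parcs = parcs (disjoint_union G H)
         \<union> (Inl ` pverts G) \<times> (Inr ` pverts H) \<union> (Inr ` pverts H) \<times> (Inl ` pverts G) \<rparr>"

lemma pair_graph_iff:
  "pair_graph G \<longleftrightarrow>
     finite (pverts G) \<and> parcs G \<subseteq> pverts G \<times> pverts G \<and> sym (parcs G) \<and> irrefl (parcs G)"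
  (is "?L \<longleftrightarrow> ?R")
proof
  assume ?L
  then interpret pair_graph G .
  show ?R
    using pair_finite_verts arc_fst_in_verts arc_snd_in_verts pair_no_loops pair_sym_arcs
    by (fastforce simp: symmetric_def irrefl_def)
next
  assume R: ?R
  then have "finite (parcs G)" by (meson finite_SigmaI finite_subset)
  with R show ?L by unfold_locales (auto simp: symmetric_def irrefl_def)
qed

lemma pair_graph_complete_graph: "pair_graph (complete_graph m)"
  by (auto simp: pair_graph_iff complete_graph_def sym_def irrefl_def)

lemma pair_graph_disjoint_union:
  "pair_graph G \<Longrightarrow> pair_graph H \<Longrightarrow> pair_graph (disjoint_union G H)"
  by (auto simp: pair_graph_iff disjoint_union_def sym_def irrefl_def; force)

lemma pair_graph_join:
  "pair_graph G \<Longrightarrow> pair_graph H \<Longrightarrow> pair_graph (join G H)"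
  using pair_graph_disjoint_union[of G H]
  by (auto simp: pair_graph_iff join_def disjoint_union_def sym_def irrefl_def)

text \<open>In a simple graph the out-degree of a vertex is its degree.\<close>

definition min_degree :: "('a, 'b) pre_digraph \<Rightarrow> nat" where
  "min_degree G = Min (out_degree G ` verts G)"

definition traceable_from :: "('a, 'b) pre_digraph \<Rightarrow> 'a \<Rightarrow> bool" where
  "traceable_from G x \<longleftrightarrow> (\<exists>p. vpath p G \<and> hd p = x \<and> set p = verts G)"

definition traceable_from_every_vertex :: "('a, 'b) pre_digraph \<Rightarrow> bool" where
  "traceable_from_every_vertex G \<longleftrightarrow> (\<forall>x \<in> verts G. traceable_from G x)"

text \<open>
  Matrices are indexed by natural numbers, so the adjacency matrix depends on an enumeration \<open>vs\<close> of
  the vertices. The largest eigenvalue does not; see \<open>mu_eq\<close> below.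
\<close>

definition adjacency_matrix :: "('a, 'b) pre_digraph \<Rightarrow> 'a list \<Rightarrow> real mat" where
  "adjacency_matrix G vs =
     mat (length vs) (length vs) (\<lambda>(i, j). if (vs ! i, vs ! j) \<in> arcs_ends G then 1 else 0)"

definition vertex_list :: "('a, 'b) pre_digraph \<Rightarrow> 'a list" where
  "vertex_list G = (SOME vs. distinct vs \<and> set vs = verts G)"

definition mu :: "('a, 'b) pre_digraph \<Rightarrow> real" where
  "mu G = Max (spectrum (adjacency_matrix G (vertex_list G)))"

lemma vertex_list:
  assumes "finite (verts G)"
  shows "distinct (vertex_list G)" "set (vertex_list G) = verts G"
proof -
  have "\<exists>vs. distinct vs \<and> set vs = verts G"
    using finite_distinct_list[OF assms] by blast
  from someI_ex[OF this] show "distinct (vertex_list G)" "set (vertex_list G) = verts G"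
    by (simp_all add: vertex_list_def)
qed

lemma adjacency_matrix_carrier:
  "adjacency_matrix G vs \<in> carrier_mat (length vs) (length vs)"
  by (simp add: adjacency_matrix_def)

lemma spectrum_adjacency_matrix_subset:
  assumes vs: "distinct vs" and ws: "distinct ws" and eq: "set vs = set ws"
  shows "spectrum (adjacency_matrix G vs) \<subseteq> spectrum (adjacency_matrix G ws)"
proof
  fix l
  assume "l \<in> spectrum (adjacency_matrix G vs)"
  define m where "m = length vs"
  have m: "length ws = m"
    using distinct_card[OF vs] distinct_card[OF ws] eq by (simp add: m_def)
  have bv: "bij_betw ((!) vs) {..<m} (set vs)" and bw: "bij_betw ((!) ws) {..<m} (set vs)"
    using bij_betw_nth[OF vs] bij_betw_nth[OF ws] eq m by (auto simp: m_def)
  define f where "f = (\<lambda>j. inv_into {..<m} ((!) vs) (ws ! j))"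
  have bf: "bij_betw f {..<m} {..<m}"
    using bij_betw_trans[OF bw bij_betw_inv_into[OF bv]] by (simp add: f_def comp_def)
  have fl: "f j < m" if "j < m" for j
    using bij_betw_apply[OF bf] that by auto
  have fv: "vs ! f j = ws ! j" if "j < m" for j
    unfolding f_def using bij_betw_inv_into_right[OF bv] bij_betw_apply[OF bw] that by auto
  from \<open>l \<in> _\<close> obtain v where v: "v \<in> carrier_vec m" "v \<noteq> 0\<^sub>v m"
    and ev: "adjacency_matrix G vs *\<^sub>v v = l \<cdot>\<^sub>v v"
    by (auto simp: spectrum_def eigenvalue_def eigenvector_def adjacency_matrix_def m_def)
  define w where "w = vec m (\<lambda>j. v $ f j)"
  have evi: "(\<Sum>i<m. (if (vs ! j, vs ! i) \<in> arcs_ends G then 1 else 0) * v $ i) = l * v $ j"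
    if "j < m" for j
    using arg_cong[OF ev, of "\<lambda>x. x $ j"] that v
    by (simp add: adjacency_matrix_def m_def[symmetric] scalar_prod_def lessThan_atLeast0)
  have "adjacency_matrix G ws *\<^sub>v w = l \<cdot>\<^sub>v w"
  proof (rule eq_vecI)
    fix j assume "j < dim_vec (l \<cdot>\<^sub>v w)"
    then have j: "j < m" by (simp add: w_def)
    have "(adjacency_matrix G ws *\<^sub>v w) $ j =
        (\<Sum>i<m. (if (ws ! j, ws ! i) \<in> arcs_ends G then 1 else 0) * v $ f i)"
      using j by (simp add: adjacency_matrix_def m w_def scalar_prod_def lessThan_atLeast0)
    also have "\<dots> = (\<Sum>i<m. (if (vs ! f j, vs ! f i) \<in> arcs_ends G then 1 else 0) * v $ f i)"
      by (rule sum.cong) (auto simp: fv j)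
    also have "\<dots> = (\<Sum>i<m. (if (vs ! f j, vs ! i) \<in> arcs_ends G then 1 else 0) * v $ i)"
      by (rule sum.reindex_bij_betw[OF bf,
            of "\<lambda>i. (if (vs ! f j, vs ! i) \<in> arcs_ends G then 1 else 0) * v $ i"])
    also have "\<dots> = (l \<cdot>\<^sub>v w) $ j"
      using evi[OF fl[OF j]] j by (simp add: w_def)
    finally show "(adjacency_matrix G ws *\<^sub>v w) $ j = (l \<cdot>\<^sub>v w) $ j" .
  qed (simp add: adjacency_matrix_def w_def m)
  moreover have "w \<noteq> 0\<^sub>v m"
  proof
    assume z: "w = 0\<^sub>v m"
    have "v $ i = 0" if i: "i < m" for i
    proof -
      obtain j where "j < m" "i = f j"
        using bf i unfolding bij_betw_def by blast
      then show ?thesis using arg_cong[OF z, of "\<lambda>x. x $ j"] by (simp add: w_def)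
    qed
    then have "v = 0\<^sub>v m" using v(1) by auto
    then show False using v(2) by blast
  qed
  ultimately show "l \<in> spectrum (adjacency_matrix G ws)"
    unfolding spectrum_def eigenvalue_def eigenvector_def
    by (auto simp: adjacency_matrix_def m w_def intro!: exI[of _ w])
qed

lemma mu_eq:
  assumes "distinct vs" "set vs = verts G"
  shows "mu G = Max (spectrum (adjacency_matrix G vs))"
proof -
  have "finite (verts G)" using assms(2) by (metis List.finite_set)
  note vl = vertex_list[OF this]
  have "spectrum (adjacency_matrix G (vertex_list G)) = spectrum (adjacency_matrix G vs)"
    using spectrum_adjacency_matrix_subset assms vl by (metis subset_antisym)
  then show ?thesis by (simp add: mu_def)
qed

text \<open>The maximum in \<open>mu\<close> is over a finite nonempty set for every nonempty graph.\<close>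

lemma finite_spectrum_adjacency_matrix: "finite (spectrum (adjacency_matrix G vs))"
  using card_finite_spectrum(1)[OF adjacency_matrix_carrier] .

lemma spectrum_adjacency_matrix_nonempty:
  assumes sym: "sym (arcs_ends G)" and ne: "vs \<noteq> []"
  shows "spectrum (adjacency_matrix G vs) \<noteq> {}"
proof -
  define m where "m = length vs"
  define a :: "nat \<Rightarrow> nat \<Rightarrow> real"
    where "a = (\<lambda>i j. if (vs ! i, vs ! j) \<in> arcs_ends G then 1 else 0)"
  define A where "A = adjacency_matrix G vs"
  define C where "C = map_mat complex_of_real A"
  have A: "A \<in> carrier_mat m m" using adjacency_matrix_carrier by (simp add: A_def m_def)
  then have C: "C \<in> carrier_mat m m" by (simp add: C_def)
  have m: "m \<noteq> 0" using ne by (simp add: m_def)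
  have asym: "a i j = a j i" for i j using sym by (auto simp: a_def sym_def)
  obtain c where c: "eigenvalue C c"
    using spectrum_non_empty[OF C] m by (auto simp: spectrum_def)
  then obtain z where z: "z \<in> carrier_vec m" "z \<noteq> 0\<^sub>v m" and ev: "C *\<^sub>v z = c \<cdot>\<^sub>v z"
    using C by (auto simp: eigenvalue_def eigenvector_def)
  have evi: "(\<Sum>j<m. of_real (a i j) * z $ j) = c * z $ i" if "i < m" for i
    using arg_cong[OF ev, of "\<lambda>x. x $ i"] that z
    by (simp add: C_def A_def a_def adjacency_matrix_def m_def[symmetric] scalar_prod_def
        lessThan_atLeast0)
  define S where "S = (\<Sum>i<m. cnj (z $ i) * z $ i)"
  define Q where "Q = (\<Sum>i<m. \<Sum>j<m. of_real (a i j) * (cnj (z $ i) * z $ j))"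
  have S: "S = of_real (\<Sum>i<m. (cmod (z $ i))\<^sup>2)"
    unfolding S_def of_real_sum by (rule sum.cong) (simp_all add: complex_mult_cnj cmod_power2 mult.commute del: of_real_power)
  have "Q = (\<Sum>i<m. cnj (z $ i) * (\<Sum>j<m. of_real (a i j) * z $ j))"
    by (simp add: Q_def sum_distrib_left mult_ac)
  also have "\<dots> = c * S"
    unfolding S_def sum_distrib_left[of c]
    by (rule sum.cong) (simp_all add: evi mult.assoc mult.left_commute)
  finally have Q: "Q = c * S" .
  have "cnj Q = (\<Sum>i<m. \<Sum>j<m. of_real (a i j) * (z $ i * cnj (z $ j)))"
    by (simp add: Q_def)
  also have "\<dots> = (\<Sum>j<m. \<Sum>i<m. of_real (a i j) * (z $ i * cnj (z $ j)))"
    by (rule sum.swap)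
  also have "\<dots> = Q"
    unfolding Q_def by (intro sum.cong refl) (simp add: asym mult_ac)
  finally have "cnj (c * S) = c * S" by (simp add: Q)
  moreover have "cnj S = S" by (simp add: S del: of_real_sum)
  moreover have "S \<noteq> 0"
  proof
    assume "S = 0"
    then have "(\<Sum>i<m. (cmod (z $ i))\<^sup>2) = 0" by (simp add: S del: of_real_sum of_real_power)
    then have "z $ i = 0" if "i < m" for i using that by (simp add: sum_nonneg_eq_0_iff)
    then have "z = 0\<^sub>v m" using z(1) by auto
    then show False using z(2) by blast
  qed
  ultimately have "cnj c = c" by simp
  then obtain r where r: "c = of_real r" by (metis Reals_cases Reals_cnj_iff)
  have "poly (char_poly C) c = 0" using c eigenvalue_root_char_poly[OF C] by simp
  then have "poly (char_poly A) r = 0"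
    by (simp add: C_def r of_real_hom.char_poly_hom[OF A])
  then show ?thesis
    using eigenvalue_root_char_poly[OF A] by (auto simp: spectrum_def A_def)
qed

end

theory Submission
  imports Defs "HOL-Analysis.Convex"
begin

text \<open>
  A graph with large spectral radius has many edges, whereas a graph with minimum degree at least
  \<open>k\<close> that has no Hamiltonian path from some vertex \<open>x\<close> has few. The argument
  compares the two bounds.

  Let \<open>A\<close> be the number of arcs, that is, twice the number of edges. Cauchy--Schwarz
  applied to each row of the eigenvalue equation gives \<open>\<mu>\<^sup>2 \<le> A\<close>
  (\<open>mu_squared_le_card_parcs\<close>). The assumed lower bound on \<open>\<mu>\<close> is at least
  \<open>n - k\<close>: with \<open>s = sqrt (n - 1)\<close> the difference is
  \<open>(s\<^sup>2 - 2 s + 1 - k) / s\<^sup>2\<close>, which is nonnegative because \<open>s \<ge> k + 1\<close> and \<open>s \<ge> 2\<close>.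
  Hence \<open>A \<ge> (n - k)\<^sup>2\<close>.

  Conversely, suppose that no Hamiltonian path starts at \<open>x\<close>, and add edges as long as this
  stays true. In the resulting graph any edge \<open>uv\<close> that is still missing would complete a
  Hamiltonian path from \<open>x\<close>. If \<open>d u + d v \<ge> n\<close>, then reversing a segment of that path
  would avoid the edge \<open>uv\<close> while keeping the starting vertex, so \<open>d u + d v < n\<close>
  (\<open>degree_sum_less_of_added_edge\<close>). Chvatal's counting of low-degree vertices turns this into
  a bound on \<open>A\<close> that depends on a number \<open>i\<close> with \<open>k \<le> i < n / 2\<close>
  (\<open>card_arcs_le_of_not_traceable\<close>). The bound is convex in \<open>i\<close>, and for
  \<open>n \<ge> 2 (k + 1)\<^sup>2\<close> it is below \<open>(n - k)\<^sup>2\<close> at both ends of the range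
  (\<open>chvatal_bound_less_square\<close>), a contradiction. So every graph that satisfies the
  hypotheses falls under the first alternative of the theorem.
\<close>

section \<open>Hamiltonian paths and the closure condition\<close>

text \<open>
  The proof changes the arcs while the vertices stay, so the two are separate arguments here.
  The degree of \<open>u\<close> is written \<open>card (E `` {u})\<close>.
\<close>

definition simple_arcs :: "'a set \<Rightarrow> 'a rel \<Rightarrow> bool" where
  "simple_arcs V E \<longleftrightarrow> E \<subseteq> V \<times> V \<and> sym E \<and> irrefl E"

definition hamiltonian_path :: "'a set \<Rightarrow> 'a rel \<Rightarrow> 'a \<Rightarrow> 'a list \<Rightarrow> bool" where
  "hamiltonian_path V E x p \<longleftrightarrow>
     distinct p \<and> set p = V \<and> hd p = x \<and> successively (\<lambda>a b. (a, b) \<in> E) p"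

lemma set_vwalk_arcs_subset_iff:
  "set (vwalk_arcs p) \<subseteq> E \<longleftrightarrow> successively (\<lambda>a b. (a, b) \<in> E) p"
  by (induction p rule: vwalk_arcs.induct) auto

lemma traceable_from_iff_hamiltonian_path:
  assumes "x \<in> pverts G"
  shows "traceable_from (with_proj G) x \<longleftrightarrow> (\<exists>p. hamiltonian_path (pverts G) (parcs G) x p)"
  using assms
  by (fastforce simp: traceable_from_def hamiltonian_path_def vpath_def vwalk_def
      set_vwalk_arcs_subset_iff)

text \<open>
  Reversing the segment at the positions from \<open>a\<close> to \<open>b - 1\<close> replaces just the two
  steps at its ends, so \<open>p\<close> itself may have gaps there.
  For \<open>b = length p\<close> the segment is a tail and only one step is replaced.
\<close>

lemma successively_reverse_segment:
  fixes E :: "'a rel"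
  assumes "sym E" "0 < a" "a < b" "b \<le> length p"
    and arcs: "\<And>m. Suc m < length p \<Longrightarrow> Suc m \<noteq> a \<Longrightarrow> Suc m \<noteq> b \<Longrightarrow> (p ! m, p ! Suc m) \<in> E"
    and new1: "(p ! (a - 1), p ! (b - 1)) \<in> E"
    and new2: "b < length p \<Longrightarrow> (p ! a, p ! b) \<in> E"
  shows "successively (\<lambda>x y. (x, y) \<in> E) (take a p @ rev (drop a (take b p)) @ drop b p)"
proof -
  define A B C where "A = take a p" and "B = drop a (take b p)" and "C = drop b p"
  have A: "successively (\<lambda>x y. (x, y) \<in> E) A"
    unfolding successively_conv_nth A_def using assms by auto
  have B: "successively (\<lambda>x y. (y, x) \<in> E) B"
    unfolding successively_conv_nth B_def
  proof (intro allI impI)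
    fix m assume m: "Suc m < length (drop a (take b p))"
    then have "(p ! (a + m), p ! Suc (a + m)) \<in> E"
      using assms by (intro arcs) auto
    with \<open>sym E\<close> have "(p ! Suc (a + m), p ! (a + m)) \<in> E" by (rule symD)
    then show "(drop a (take b p) ! Suc m, drop a (take b p) ! m) \<in> E"
      using m assms by simp
  qed
  have C: "successively (\<lambda>x y. (x, y) \<in> E) C"
    unfolding successively_conv_nth C_def using assms by auto
  have nA: "A \<noteq> []" and nB: "B \<noteq> []" using assms by (auto simp: A_def B_def)
  have "last A = p ! (a - 1)" "last B = p ! (b - 1)" "hd B = p ! a"
    using nA nB assms by (auto simp: A_def B_def last_conv_nth hd_drop_conv_nth min_def)
  moreover have "C = [] \<or> (p ! a, hd C) \<in> E"
    using new2 by (cases "b < length p") (auto simp: C_def hd_drop_conv_nth)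
  ultimately show ?thesis
    using A B C nA nB new1
    by (auto simp: successively_append_iff hd_rev last_rev A_def[symmetric] B_def[symmetric]
        C_def[symmetric])
qed

text \<open>
  Let the sequence \<open>p\<close> be a path except for the step from \<open>p ! i\<close> to \<open>p ! Suc i\<close>. If
  \<open>p ! i\<close> is adjacent to \<open>p ! j\<close> and \<open>p ! Suc i\<close> to \<open>p ! Suc j\<close>, these two edges can
  replace the steps at \<open>i\<close> and at \<open>j\<close> by a reversal, and this repairs \<open>p\<close> without
  moving its head. So the successors of the neighbours of \<open>p ! i\<close> are not neighbours of
  \<open>p ! Suc i\<close>, and counting positions bounds the sum of the two degrees.
\<close>

lemma degree_sum_less_of_gap:
  fixes E :: "'a rel"
  assumes E: "simple_arcs V E" and p: "distinct p" "set p = V"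
    and i: "Suc i < length p"
    and arcs: "\<And>m. Suc m < length p \<Longrightarrow> m \<noteq> i \<Longrightarrow> (p ! m, p ! Suc m) \<in> E"
    and gap: "(p ! i, p ! Suc i) \<notin> E"
    and no: "\<nexists>q. hamiltonian_path V E (hd p) q"
  shows "card (E `` {p ! i}) + card (E `` {p ! Suc i}) < card V"
proof -
  define n where "n = length p"
  define J where "J = {j. j < n \<and> (p ! i, p ! j) \<in> E}"
  define I where "I = {j. j < n \<and> (p ! Suc i, p ! j) \<in> E}"
  have sym: "sym E" and irr: "\<And>x. (x, x) \<notin> E" and sub: "E \<subseteq> V \<times> V"
    using E by (auto simp: simple_arcs_def irrefl_def)
  \<comment> \<open>A reversal with the gap at one of its ends would produce a Hamiltonian path.\<close>
  have no_reversal: False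
    if ab: "0 < a" "a < b" "b \<le> n"
      and old: "\<And>m. Suc m < n \<Longrightarrow> Suc m \<noteq> a \<Longrightarrow> Suc m \<noteq> b \<Longrightarrow> m \<noteq> i"
      and "(p ! (a - 1), p ! (b - 1)) \<in> E" "b < n \<Longrightarrow> (p ! a, p ! b) \<in> E" for a b
  proof -
    define q where "q = take a p @ rev (drop a (take b p)) @ drop b p"
    have "p = take a p @ drop a (take b p) @ drop b p"
      using ab by (metis append.assoc append_take_drop_id less_imp_le min.absorb2 take_take min.commute)
    then have "mset q = mset p"
      unfolding q_def by (metis mset_append mset_rev)
    then have "distinct q" "set q = V"
      using p by (metis mset_eq_imp_distinct_iff, metis mset_eq_setD)
    moreover have "hd q = hd p"
      using ab by (cases p) (auto simp: q_def n_def take_Cons split: nat.splits)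
    moreover have "successively (\<lambda>x y. (x, y) \<in> E) q"
      unfolding q_def
      by (rule successively_reverse_segment) (use sym that arcs in \<open>auto simp: n_def\<close>)
    ultimately show False using no by (auto simp: hamiltonian_path_def)
  qed
  have shift: "Suc j \<notin> I" if j: "j \<in> J" for j
  proof
    assume I: "Suc j \<in> I"
    have e: "(p ! i, p ! j) \<in> E" "(p ! Suc i, p ! Suc j) \<in> E" "Suc j < n"
      using j I by (auto simp: J_def I_def)
    have "j \<noteq> i" using e irr by auto
    then consider "j < i" | "i < j" by linarith
    then show False
    proof cases
      case 1
      show False
        by (rule no_reversal[of "Suc j" "Suc i"]) (use 1 e sym i in \<open>auto simp: n_def dest: symD\<close>)
    next
      case 2
      show False
        by (rule no_reversal[of "Suc i" "Suc j"]) (use 2 e i in \<open>auto simp: n_def\<close>)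
    qed
  qed
  \<comment> \<open>A neighbour in the last position has no successor; reversing the whole tail covers it.
      Hence all successors lie below \<open>n\<close>.\<close>
  have last: "n - 1 \<notin> J"
  proof
    assume "n - 1 \<in> J"
    then have e: "(p ! i, p ! (n - 1)) \<in> E" by (simp add: J_def)
    then have "i \<noteq> n - 1" using irr by auto
    moreover have "n - 1 \<noteq> Suc i" using e gap by auto
    ultimately show False
      by (intro no_reversal[of "Suc i" n]) (use e i in \<open>auto simp: n_def\<close>)
  qed
  have fin: "finite I" "finite J" by (auto simp: I_def J_def)
  have "Suc j < n" if "j \<in> J" for j
    using that last by (cases "j = n - 1") (auto simp: J_def)
  then have "insert (Suc i) (Suc ` J \<union> I) \<subseteq> {..<n}"
    using i by (auto simp: I_def n_def)
  \<comment> \<open>The position \<open>Suc i\<close> is in neither set since there are no loops; this extra position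
      makes the inequality strict.\<close>
  then have "card (insert (Suc i) (Suc ` J \<union> I)) \<le> n"
    by (metis card_lessThan card_mono finite_lessThan)
  moreover have "Suc i \<notin> Suc ` J \<union> I" using irr by (auto simp: J_def I_def)
  moreover have "card (Suc ` J \<union> I) = card J + card I"
    using shift fin by (subst card_Un_disjoint) (auto simp: card_image)
  ultimately have le: "card J + card I < n" using fin by auto
  have nbhd: "card (E `` {w}) = card {j. j < n \<and> (w, p ! j) \<in> E}" for w
  proof -
    have "bij_betw ((!) p) {j. j < n \<and> (w, p ! j) \<in> E} (E `` {w})"
      unfolding bij_betw_def
    proof
      show "inj_on ((!) p) {j. j < n \<and> (w, p ! j) \<in> E}"
        using p(1) by (auto simp: inj_on_def n_def nth_eq_iff_index_eq)
      show "(!) p ` {j. j < n \<and> (w, p ! j) \<in> E} = E `` {w}"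
      proof
        show "E `` {w} \<subseteq> (!) p ` {j. j < n \<and> (w, p ! j) \<in> E}"
        proof
          fix y assume y: "y \<in> E `` {w}"
          then have "y \<in> set p" using sub p by auto
          then obtain j where "j < n" "p ! j = y" by (auto simp: in_set_conv_nth n_def)
          then show "y \<in> (!) p ` {j. j < n \<and> (w, p ! j) \<in> E}" using y by auto
        qed
      qed auto
    qed
    then show ?thesis by (simp add: bij_betw_same_card)
  qed
  have "card V = n" using p distinct_card n_def by metis
  then show ?thesis using le by (simp add: nbhd I_def J_def)
qed

text \<open>
  The closure step. A Hamiltonian path that exists only thanks to \<open>uv\<close> uses this edge, and it
  does so once because it does not repeat vertices; removing it leaves a single gap. The new path
  starts at \<open>x\<close> again, which is why the threshold is \<open>n\<close> as for Hamiltonian cycles, and not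
  \<open>n - 1\<close> as for Hamiltonian paths with free ends.
\<close>

lemma degree_sum_less_of_added_edge:
  fixes E :: "'a rel"
  assumes E: "simple_arcs V E" and uv: "(u, v) \<notin> E" 
    and no: "\<nexists>q. hamiltonian_path V E x q"
    and p: "hamiltonian_path V (E \<union> {(u, v), (v, u)}) x p"
  shows "card (E `` {u}) + card (E `` {v}) < card V"
proof -
  have sym: "sym E" using E by (simp add: simple_arcs_def)
  have p': "distinct p" "set p = V" "hd p = x"
    and arcs: "\<And>m. Suc m < length p \<Longrightarrow> (p ! m, p ! Suc m) \<in> E \<union> {(u, v), (v, u)}"
    using p by (auto simp: hamiltonian_path_def successively_conv_nth)
  obtain i where i: "Suc i < length p" "(p ! i, p ! Suc i) \<notin> E"
    using no p' by (auto simp: hamiltonian_path_def successively_conv_nth)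
  then have ends: "{p ! i, p ! Suc i} = {u, v}" using arcs[OF i(1)] by auto
  have "(p ! m, p ! Suc m) \<in> E" if m: "Suc m < length p" "m \<noteq> i" for m
  proof (rule ccontr)
    assume "(p ! m, p ! Suc m) \<notin> E"
    then have "{p ! m, p ! Suc m} = {p ! i, p ! Suc i}" using arcs[OF m(1)] ends by auto
    then show False
      using m i(1) p'(1) by (auto simp: doubleton_eq_iff nth_eq_iff_index_eq)
  qed
  then have "card (E `` {p ! i}) + card (E `` {p ! Suc i}) < card V"
    using degree_sum_less_of_gap[OF E p'(1,2) i(1)] i(2) no p'(3) by auto
  then show ?thesis using ends by (auto simp: doubleton_eq_iff)
qed

section \<open>Few arcs in a graph that is not traceable\<close>

lemma card_arcs_eq_sum_degrees:
  assumes "finite V" "E \<subseteq> V \<times> V"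
  shows "card E = (\<Sum>u\<in>V. card (E `` {u}))"
proof -
  have "E = Sigma V (\<lambda>u. E `` {u})" using assms by auto
  moreover have "finite (E `` {u})" for u using assms by (meson finite_Image finite_SigmaI finite_subset)
  ultimately show ?thesis using assms(1) by (metis card_SigmaI)
qed

lemma card_nonneighbours:
  assumes "finite V" "E \<subseteq> V \<times> V"
  shows "card (V - E `` {u}) = card V - card (E `` {u})"
  using assms by (intro card_Diff_subset) (auto intro: finite_subset[of _ V])

text \<open>
  The sets \<open>S\<close> and \<open>T\<close> may overlap. Choosing \<open>i\<close> elements of \<open>S\<close> leaves
  at least \<open>n - 2 i\<close> elements of \<open>T\<close>, and the \<open>i\<close> vertices that remain after
  choosing these have degree at most \<open>n - 1\<close>. The three summands are these three groups.
\<close>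

lemma sum_degrees_le:
  fixes d :: "'a \<Rightarrow> nat"
  assumes V: "finite V" "card V = n" and i: "2 * i < n"
    and d: "\<And>w. w \<in> V \<Longrightarrow> d w \<le> n - 1"
    and S: "S \<subseteq> V" "i \<le> card S" "\<And>w. w \<in> S \<Longrightarrow> d w \<le> i"
    and T: "T \<subseteq> V" "n - i \<le> card T" "\<And>w. w \<in> T \<Longrightarrow> d w \<le> n - 1 - i"
  shows "(\<Sum>w\<in>V. d w) \<le> i * i + (n - 2 * i) * (n - 1 - i) + i * (n - 1)"
proof -
  have fin: "finite S" "finite T" using V(1) S(1) T(1) finite_subset by auto
  obtain S' where S': "S' \<subseteq> S" "card S' = i"
    using S(2) obtain_subset_with_card_n by metis
  have finS': "finite S'" using S'(1) fin finite_subset by auto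
  have "n - 2 * i \<le> card (T - S')"
    using T(2) S'(2) diff_card_le_card_Diff[OF finS', of T] i by linarith
  then obtain T' where T': "T' \<subseteq> T - S'" "card T' = n - 2 * i"
    using obtain_subset_with_card_n by metis
  have finT': "finite T'" using T'(1) fin finite_subset by blast
  define R where "R = V - (S' \<union> T')"
  have disj: "S' \<inter> T' = {}" using T'(1) by auto
  have sub: "S' \<union> T' \<subseteq> V" using S' T' S T by auto
  have "card R = i"
    using i V(2) S'(2) T'(2) sub finS' finT' card_Un_disjoint[OF finS' finT' disj]
    by (simp add: R_def card_Diff_subset)
  have "(\<Sum>w\<in>V. d w) = (\<Sum>w\<in>S' \<union> T'. d w) + (\<Sum>w\<in>R. d w)"
    using sum.subset_diff[OF sub V(1)] by (simp add: R_def add.commute)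
  also have "\<dots> = (\<Sum>w\<in>S'. d w) + (\<Sum>w\<in>T'. d w) + (\<Sum>w\<in>R. d w)"
    by (simp add: sum.union_disjoint finS' finT' disj)
  also have "\<dots> \<le> i * i + (n - 2 * i) * (n - 1 - i) + i * (n - 1)"
    using sum_bounded_above[of S' d i] sum_bounded_above[of T' d "n - 1 - i"]
      sum_bounded_above[of R d "n - 1"] S' T' S(3) T(3) d \<open>card R = i\<close>
    by (intro add_mono) (auto simp: R_def subset_iff)
  finally show ?thesis .
qed

lemma hamiltonian_path_complete:
  assumes "finite V" "x \<in> V" and all: "\<And>u v. u \<in> V \<Longrightarrow> v \<in> V \<Longrightarrow> u \<noteq> v \<Longrightarrow> (u, v) \<in> E"
  shows "\<exists>p. hamiltonian_path V E x p"
proof -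
  obtain xs where xs: "distinct xs" "set xs = V - {x}"
    using finite_distinct_list[of "V - {x}"] assms(1) by auto
  have "distinct (x # xs)" using xs by simp
  then have "successively (\<noteq>) (x # xs)"
    unfolding successively_conv_nth by (metis Suc_lessD n_not_Suc_n nth_eq_iff_index_eq)
  then have "successively (\<lambda>a b. (a, b) \<in> E) (x # xs)"
    by (rule successively_mono) (use xs assms(2) all in auto)
  then show ?thesis
    using xs assms(2) by (intro exI[of _ "x # xs"]) (auto simp: hamiltonian_path_def)
qed

text \<open>
  Among the pairs of distinct nonadjacent vertices take \<open>u\<close>, \<open>v\<close> with \<open>d u + d v\<close>
  maximal and \<open>d u \<le> d v\<close>, and put \<open>i = d u\<close>. By maximality, every vertex not adjacent to
  \<open>v\<close> has degree at most \<open>d u\<close>, and every vertex not adjacent to \<open>u\<close> has degree at most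
  \<open>d v\<close>. As \<open>d u + d v < n\<close>, there are enough vertices of both kinds.
\<close>

lemma card_arcs_le_of_edge_maximal:
  fixes E :: "'a rel"
  assumes fin: "finite V" and x: "x \<in> V" and E: "simple_arcs V E"
    and no: "\<nexists>p. hamiltonian_path V E x p"
    and max: "\<And>E'. simple_arcs V E' \<Longrightarrow> E \<subset> E' \<Longrightarrow> \<exists>p. hamiltonian_path V E' x p"
    and n: "card V = n" and k: "\<And>u. u \<in> V \<Longrightarrow> k \<le> card (E `` {u})"
  shows "\<exists>i\<ge>k. 2 * i < n \<and> card E \<le> i * i + (n - 2 * i) * (n - 1 - i) + i * (n - 1)"
proof -
  define d where "d u = card (E `` {u})" for u
  have sub: "E \<subseteq> V \<times> V" and sym: "sym E" and irr: "\<And>u. (u, u) \<notin> E"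
    using E by (auto simp: simple_arcs_def irrefl_def)
  have less: "d u + d v < n" if uv: "u \<in> V" "v \<in> V" "u \<noteq> v" "(u, v) \<notin> E" for u v
  proof -
    have "simple_arcs V (E \<union> {(u, v), (v, u)})"
      using E uv by (auto simp: simple_arcs_def sym_def irrefl_def)
    then obtain p where "hamiltonian_path V (E \<union> {(u, v), (v, u)}) x p"
      using max[of "E \<union> {(u, v), (v, u)}"] uv by blast
    from degree_sum_less_of_added_edge[OF E uv(4) no this] show ?thesis
      by (simp add: d_def n)
  qed
  define N where "N = {(u, v) \<in> V \<times> V. u \<noteq> v \<and> (u, v) \<notin> E}"
  have finN: "finite N" using fin by (auto simp: N_def intro: finite_subset[of _ "V \<times> V"])
  have "N \<noteq> {}"
    using hamiltonian_path_complete[OF fin x, of E] no by (auto simp: N_def)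
  define D where "D = (\<lambda>(u, v). d u + d v) ` N"
  have "Max D \<in> D" using finN \<open>N \<noteq> {}\<close> by (auto simp: D_def)
  then obtain u0 v0 where uv0: "(u0, v0) \<in> N" "d u0 + d v0 = Max D" by (auto simp: D_def)
  have maxD: "d a + d b \<le> Max D" if "(a, b) \<in> N" for a b
    using that finN by (auto simp: D_def intro!: Max_ge)
  have symN: "(b, a) \<in> N" if "(a, b) \<in> N" for a b
    using that sym by (auto simp: N_def dest: symD)
  obtain u v where uv: "(u, v) \<in> N" "d u + d v = Max D" "d u \<le> d v"
    using uv0 symN[OF uv0(1)] by (metis add.commute nat_le_linear)
  define i where "i = d u"
  have uvV: "u \<in> V" "v \<in> V" "u \<noteq> v" "(u, v) \<notin> E" "(v, u) \<notin> E"
    using uv(1) symN[OF uv(1)] by (auto simp: N_def)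
  have sumlt: "d u + d v < n" using less uvV by auto
  have "(\<Sum>w\<in>V. d w) \<le> i * i + (n - 2 * i) * (n - 1 - i) + i * (n - 1)"
  proof (rule sum_degrees_le[OF fin n])
    show "2 * i < n" using sumlt uv(3) by (simp add: i_def)
    show "d w \<le> n - 1" if "w \<in> V" for w
    proof -
      have "card (E `` {w}) \<le> card (V - {w})"
        using sub irr fin by (intro card_mono) auto
      then show ?thesis using that fin n by (simp add: d_def)
    qed
    show "V - E `` {v} - {v} \<subseteq> V" "V - E `` {u} \<subseteq> V" by auto
    have "v \<in> V - E `` {v}" using irr uvV by auto
    then have "card (V - E `` {v} - {v}) = n - d v - 1"
      using fin card_nonneighbours[OF fin sub, of v] by (simp add: n d_def)
    then show "i \<le> card (V - E `` {v} - {v})" using sumlt by (simp add: i_def)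
    show "d w \<le> i" if "w \<in> V - E `` {v} - {v}" for w
    proof -
      have "(v, w) \<in> N" using that uvV by (auto simp: N_def)
      then show ?thesis using maxD[of v w] uv(2) by (simp add: i_def)
    qed
    show "n - i \<le> card (V - E `` {u})"
      using card_nonneighbours[OF fin sub, of u] by (simp add: n d_def i_def)
    show "d w \<le> n - 1 - i" if w: "w \<in> V - E `` {u}" for w
    proof (cases "w = u")
      case True
      then show ?thesis using sumlt uv(3) by (simp add: i_def)
    next
      case False
      then have "(u, w) \<in> N" using w uvV by (auto simp: N_def)
      then show ?thesis using maxD[of u w] uv(2) sumlt by (simp add: i_def)
    qed
  qed
  moreover have "k \<le> i" using k[of u] uvV by (simp add: i_def d_def)
  moreover have "2 * i < n" using sumlt uv(3) by (simp add: i_def)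
  ultimately show ?thesis using card_arcs_eq_sum_degrees[OF fin sub] by (auto simp: d_def)
qed

lemma card_arcs_le_of_not_traceable:
  fixes E :: "'a rel"
  assumes fin: "finite V" and x: "x \<in> V" and E: "simple_arcs V E"
    and no: "\<nexists>p. hamiltonian_path V E x p"
    and n: "card V = n" and k: "\<And>u. u \<in> V \<Longrightarrow> k \<le> card (E `` {u})"
  shows "\<exists>i\<ge>k. 2 * i < n \<and> card E \<le> i * i + (n - 2 * i) * (n - 1 - i) + i * (n - 1)"
proof -
  define X where "X = {E'. simple_arcs V E' \<and> E \<subseteq> E' \<and> (\<nexists>p. hamiltonian_path V E' x p)}"
  have "X \<subseteq> Pow (V \<times> V)" by (auto simp: X_def simple_arcs_def)
  then have "finite X" using fin by (meson finite_Pow_iff finite_SigmaI finite_subset)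
  moreover have "E \<in> X" using E no by (auto simp: X_def)
  ultimately obtain F where F: "F \<in> X" "E \<subseteq> F" and max: "\<And>F'. F' \<in> X \<Longrightarrow> F \<subseteq> F' \<Longrightarrow> F' = F"
    using finite_has_maximal2[of X E] by metis
  have "F \<subseteq> V \<times> V" using F(1) by (simp add: X_def simple_arcs_def)
  then have finF: "finite F" using fin by (meson finite_SigmaI finite_subset)
  have "\<exists>i\<ge>k. 2 * i < n \<and> card F \<le> i * i + (n - 2 * i) * (n - 1 - i) + i * (n - 1)"
  proof (rule card_arcs_le_of_edge_maximal[OF fin x _ _ _ n])
    show "simple_arcs V F" "\<nexists>p. hamiltonian_path V F x p" using F(1) by (auto simp: X_def)
    show "\<exists>p. hamiltonian_path V F' x p" if "simple_arcs V F'" "F \<subset> F'" for F'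
      using max[of F'] that F by (auto simp: X_def)
    show "k \<le> card (F `` {u})" if "u \<in> V" for u
    proof -
      have "card (E `` {u}) \<le> card (F `` {u})"
        using F(2) finF by (intro card_mono) auto
      then show ?thesis using k[OF that] by simp
    qed
  qed
  moreover have "card E \<le> card F" using F(2) finF by (rule card_mono[rotated])
  ultimately show ?thesis by (meson le_trans)
qed

section \<open>The spectral radius and the number of arcs\<close>

text \<open>
  For an eigenvector \<open>v\<close>, each entry \<open>\<mu> v\<^sub>i\<close> is the inner product of row \<open>i\<close> with \<open>v\<close>.
  Squaring, applying Cauchy--Schwarz and summing over \<open>i\<close> bounds \<open>\<mu>\<^sup>2\<close> by the sum of the
  squared matrix entries, which is the number of arcs.
\<close>

lemma mu_squared_le_card_parcs:
  fixes G :: "'a pair_pre_digraph"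
  assumes G: "pair_graph G" and ne: "pverts G \<noteq> {}"
  shows "(mu (with_proj G))\<^sup>2 \<le> real (card (parcs G))"
proof -
  have fin: "finite (pverts G)" and sub: "parcs G \<subseteq> pverts G \<times> pverts G" and sym: "sym (parcs G)"
    using G by (auto simp: pair_graph_iff)
  obtain vs where vs: "distinct vs" "set vs = pverts G" using fin finite_distinct_list by metis
  define m where "m = length vs"
  define A where "A = adjacency_matrix (with_proj G) vs"
  define a :: "nat \<Rightarrow> nat \<Rightarrow> real"
    where "a = (\<lambda>i j. if (vs ! i, vs ! j) \<in> parcs G then 1 else 0)"
  define l where "l = mu (with_proj G)"
  have "l = Max (spectrum A)" using mu_eq[of vs "with_proj G"] vs by (simp add: l_def A_def)
  moreover have "spectrum A \<noteq> {}"
    unfolding A_def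
    by (rule spectrum_adjacency_matrix_nonempty) (use sym vs ne in auto)
  ultimately have "l \<in> spectrum A"
    using finite_spectrum_adjacency_matrix unfolding A_def by (metis Max_in)
  then obtain v where v: "v \<in> carrier_vec m" "v \<noteq> 0\<^sub>v m" and ev: "A *\<^sub>v v = l \<cdot>\<^sub>v v"
    by (auto simp: spectrum_def eigenvalue_def eigenvector_def adjacency_matrix_def m_def A_def)
  have evi: "l * v $ i = (\<Sum>j<m. a i j * v $ j)" if "i < m" for i
    using arg_cong[OF ev, of "\<lambda>x. x $ i"] that v
    by (simp add: A_def a_def adjacency_matrix_def m_def[symmetric] scalar_prod_def
        lessThan_atLeast0)
  define Q where "Q = (\<Sum>j<m. (v $ j)\<^sup>2)"
  have "l\<^sup>2 * Q = (\<Sum>i<m. (l * v $ i)\<^sup>2)"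
    by (simp add: Q_def sum_distrib_left power_mult_distrib)
  also have "\<dots> \<le> (\<Sum>i<m. (\<Sum>j<m. (a i j)\<^sup>2) * Q)"
    using Cauchy_Schwarz_ineq_sum[of "a _" "($) v" "{..<m}"]
    by (intro sum_mono) (simp add: evi Q_def)
  also have "\<dots> = (\<Sum>i<m. \<Sum>j<m. (a i j)\<^sup>2) * Q" by (simp add: sum_distrib_right)
  finally have le: "l\<^sup>2 * Q \<le> (\<Sum>i<m. \<Sum>j<m. (a i j)\<^sup>2) * Q" .
  have "Q > 0"
  proof (rule ccontr)
    assume "\<not> Q > 0"
    then have "Q = 0" using sum_nonneg[of "{..<m}" "\<lambda>j. (v $ j)\<^sup>2"] by (simp add: Q_def)
    then have "v $ i = 0" if "i < m" for i using that by (simp add: Q_def sum_nonneg_eq_0_iff)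
    then have "v = 0\<^sub>v m" using v(1) by auto
    then show False using v(2) by blast
  qed
  then have "l\<^sup>2 \<le> (\<Sum>i<m. \<Sum>j<m. (a i j)\<^sup>2)" using le by simp
  also have "\<dots> = real (card (parcs G))"
  proof -
    have bij: "bij_betw ((!) vs) {..<m} (pverts G)" 
      using bij_betw_nth[OF vs(1), of "{..<m}" "pverts G"] vs(2) by (simp add: m_def)
    have "(\<Sum>i<m. \<Sum>j<m. (a i j)\<^sup>2) = (\<Sum>i<m. \<Sum>y\<in>pverts G. of_bool ((vs ! i, y) \<in> parcs G))"
    proof (intro sum.cong refl)
      fix i
      have "(\<Sum>j<m. (a i j)\<^sup>2) = (\<Sum>j<m. of_bool ((vs ! i, vs ! j) \<in> parcs G))"
        by (intro sum.cong refl) (simp add: a_def)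
      also have "\<dots> = (\<Sum>y\<in>pverts G. of_bool ((vs ! i, y) \<in> parcs G))"
        by (rule sum.reindex_bij_betw[OF bij])
      finally show "(\<Sum>j<m. (a i j)\<^sup>2) = (\<Sum>y\<in>pverts G. of_bool ((vs ! i, y) \<in> parcs G))" .
    qed
    also have "\<dots> = (\<Sum>x\<in>pverts G. \<Sum>y\<in>pverts G. of_bool ((x, y) \<in> parcs G))"
      by (rule sum.reindex_bij_betw[OF bij])
    also have "\<dots> = (\<Sum>x\<in>pverts G. real (card (parcs G `` {x})))"
    proof (intro sum.cong refl)
      fix x
      have "pverts G \<inter> {y. (x, y) \<in> parcs G} = parcs G `` {x}" using sub by auto
      then show "(\<Sum>y\<in>pverts G. of_bool ((x, y) \<in> parcs G)) = real (card (parcs G `` {x}))"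
        using fin by simp
    qed
    finally show ?thesis using card_arcs_eq_sum_degrees[OF fin sub] by simp
  qed
  finally show ?thesis by (simp add: l_def)
qed

section \<open>Comparing the two bounds\<close>

text \<open>
  The difference of the two sides is a concave quadratic \<open>g\<close> in \<open>i\<close>, so its sign need
  only be known at \<open>i = k\<close> and \<open>i = (n - 1) / 2\<close>. There \<open>g k = n - 2 k\<^sup>2 - k\<close>, and
  \<open>4 g ((n - 1) / 2) = n (n + 4 - 8 k) + 4 k\<^sup>2 - 1\<close>.
\<close>

lemma chvatal_bound_less_square:
  fixes i k n :: nat
  assumes n: "2 * (k + 1)\<^sup>2 \<le> n" and i: "k \<le> i" "2 * i < n"
  shows "i * i + (n - 2 * i) * (n - 1 - i) + i * (n - 1) < (n - k)\<^sup>2"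
proof -
  define N I K where "N = int n" and "I = int i" and "K = int k"
  have N: "2 * K\<^sup>2 + 4 * K + 2 \<le> N"
    using n unfolding N_def K_def by (simp add: power2_eq_square algebra_simps flip: of_nat_mult of_nat_add)
  have b: "0 \<le> K" "K \<le> I" "2 * I \<le> N - 1" using i by (auto simp: N_def I_def K_def)
  define g where "g = (\<lambda>x. N - 2 * N * K + K\<^sup>2 + x * (2 * N - 1) - 3 * x\<^sup>2)"
  have gI: "(N - K)\<^sup>2 - (I * I + (N - 2 * I) * (N - 1 - I) + I * (N - 1)) = g I"
    by (simp add: g_def power2_eq_square algebra_simps)
  have "0 < g I"
    \<comment> \<open>The sign of the chord slope between \<open>K\<close> and \<open>I\<close> decides which end to compare with.\<close>
  proof (cases "3 * (I + K) \<le> 2 * N - 1")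
    case True
    have "g I = N - 2 * K\<^sup>2 - K + (I - K) * (2 * N - 1 - 3 * (I + K))"
      by (simp add: g_def power2_eq_square algebra_simps)
    moreover have "0 \<le> (I - K) * (2 * N - 1 - 3 * (I + K))" using True b by simp
    ultimately show ?thesis using N b by linarith
  next
    case False
    have "4 * g I = 4 * N - 8 * N * K + 4 * K\<^sup>2 + N\<^sup>2 - 1
        + (N - 1 - 2 * I) * (6 * I + 3 * (N - 1) - 2 * (2 * N - 1))"
      by (simp add: g_def power2_eq_square algebra_simps)
    moreover have "0 \<le> (N - 1 - 2 * I) * (6 * I + 3 * (N - 1) - 2 * (2 * N - 1))"
    proof (rule mult_nonneg_nonneg)
      show "0 \<le> N - 1 - 2 * I" using b by linarith
      have "2 * N \<le> 3 * (I + K)" using False by presburger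
      then show "0 \<le> 6 * I + 3 * (N - 1) - 2 * (2 * N - 1)" using b by (simp add: algebra_simps)
    qed
    moreover have "0 < 4 * N - 8 * N * K + 4 * K\<^sup>2 + N\<^sup>2 - 1"
    proof -
      have "0 \<le> (K - 1)\<^sup>2" by simp
      then have "1 \<le> N + 4 - 8 * K" using N b by (simp add: power2_eq_square algebra_simps)
      then have "N * 1 \<le> N * (N + 4 - 8 * K)" using b by (intro mult_left_mono) auto
      moreover have "2 \<le> N" using N b zero_le_power2[of K] by linarith
      moreover have "N * (N + 4 - 8 * K) = 4 * N - 8 * N * K + N\<^sup>2"
        by (simp add: power2_eq_square algebra_simps)
      ultimately show ?thesis using zero_le_power2[of K] by linarith
    qed
    ultimately show ?thesis by linarith
  qed
  then have "I * I + (N - 2 * I) * (N - 1 - I) + I * (N - 1) < (N - K)\<^sup>2" using gI by linarith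
  moreover have "int (i * i + (n - 2 * i) * (n - 1 - i) + i * (n - 1))
      = I * I + (N - 2 * I) * (N - 1 - I) + I * (N - 1)"
    using i by (simp add: N_def I_def of_nat_diff)
  moreover have "int ((n - k)\<^sup>2) = (N - K)\<^sup>2"
    using i by (simp add: N_def K_def of_nat_diff)
  ultimately show ?thesis by linarith
qed

theorem traceable_from_every_vertex_of_mu_ge:
  fixes G :: "'a pair_pre_digraph" and n k :: nat
  assumes G: "pair_graph G" and n: "card (pverts G) = n" and nk: "n \<ge> 2 * (k + 1)^2"
    and deg: "min_degree G \<ge> k" and mu: "mu G \<ge> real n - real k"
  shows "traceable_from_every_vertex G"
  unfolding traceable_from_every_vertex_def with_proj_simps
proof (rule ballI, rule ccontr)
  fix x assume x: "x \<in> pverts G" and "\<not> traceable_from (with_proj G) x"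
  then have no: "\<nexists>p. hamiltonian_path (pverts G) (parcs G) x p"
    by (simp add: traceable_from_iff_hamiltonian_path)
  have fin: "finite (pverts G)" and arcs: "simple_arcs (pverts G) (parcs G)"
    using G by (auto simp: pair_graph_iff simple_arcs_def)
  have "k \<le> card (parcs G `` {u})" if u: "u \<in> pverts G" for u
  proof -
    have "Min (out_degree (with_proj G) ` pverts G) \<le> out_degree (with_proj G) u"
      by (rule Min_le) (use u fin in auto)
    then have "k \<le> out_degree (with_proj G) u"
      using deg by (simp add: min_degree_def)
    also have "out_arcs (with_proj G) u = Pair u ` (parcs G `` {u})"
      by (auto simp: out_arcs_def)
    then have "out_degree (with_proj G) u = card (parcs G `` {u})"
      by (simp add: out_degree_def card_image inj_on_def)
    finally show ?thesis .
  qed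
  from card_arcs_le_of_not_traceable[OF fin x arcs no n this]
  obtain i where i: "k \<le> i" "2 * i < n"
    and le: "card (parcs G) \<le> i * i + (n - 2 * i) * (n - 1 - i) + i * (n - 1)" by blast
  then have "card (parcs G) < (n - k)\<^sup>2" using chvatal_bound_less_square[OF nk i] by linarith
  then have "real (card (parcs G)) < (real (n - k))\<^sup>2"
    by (metis of_nat_less_iff of_nat_power)
  also have "\<dots> \<le> (mu G)\<^sup>2" using mu i by (intro power_mono) (auto simp: of_nat_diff)
  also have "\<dots> \<le> real (card (parcs G))" using mu_squared_le_card_parcs[OF G] x by auto
  finally show False by simp
qed

theorem theorem2p11:
  fixes G :: "'a pair_pre_digraph" and n k :: nat
  assumes "pair_graph G"
    and "card (pverts G) = n"
    and "k \<ge> 1" and "n \<ge> 2 * (k + 1)^2"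
    and "min_degree G \<ge> k"
    and "mu G \<ge> (real n)^2 / (real n - 1) - real n * real k / (real n - 1)
           - 2 / sqrt (real n - 1)"
  shows "traceable_from_every_vertex G
    \<or> digraph_iso G
         (join (complete_graph 1)
            (disjoint_union (complete_graph (n - k - 1)) (complete_graph k)))"
proof -
  define s where "s = sqrt (real n - 1)"
  have "real n \<ge> 2 * (real k + 1)\<^sup>2"
    using of_nat_mono[OF assms(4), where 'a = real] by (simp add: add.commute)
  then have n1: "real n - 1 \<ge> (real k + 1)\<^sup>2"
    using one_le_power[of "real k + 1" 2] by linarith
  then have ks: "real k + 1 \<le> s" unfolding s_def by (rule real_le_rsqrt)
  then have s: "2 \<le> s" using assms(3) by linarith
  have "0 \<le> real n - 1" using n1 by (meson order_trans zero_le_power2)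
  then have s2: "real n = s\<^sup>2 + 1" by (simp add: s_def)
  have "(real n)^2 / (real n - 1) - real n * real k / (real n - 1) - 2 / s - (real n - real k)
      = (s\<^sup>2 - 2 * s + 1 - real k) / s\<^sup>2"
    using s by (simp add: s2 field_simps power2_eq_square)
  also have "\<dots> \<ge> 0"
  proof -
    have "0 \<le> (s - 2) * (s - 1)" using s by simp
    then have "0 \<le> s\<^sup>2 - 2 * s + 1 - real k"
      using ks by (simp add: power2_eq_square algebra_simps)
    then show ?thesis by simp
  qed
  finally have "mu G \<ge> real n - real k" using assms(6) unfolding s_def by linarith
  then show ?thesis using traceable_from_every_vertex_of_mu_ge assms(1,2,4,5) by blast
qed

end
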